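(* Let $X\subseteq\mathbb{R}^2$ be a connected closed region, let $\alpha>1$, and consider the pursuit-evasion game on $X$ with capture radius $l=0$. Then for every initial state $(x_{p0},x_{e0})\in X\times X$ with $x_{p0}\neq x_{e0}$, the evader's reachable region equals its dominance region: $$\mathcal{R}_e(x_{p0},x_{e0})=\mathcal{D}(x_{p0},x_{e0}).$$
   Context: Game. One pursuer and one evader move in a connected closed region $X\subseteq\mathbb{R}^2$ (the complement $\mathbb{R}^2\setminus X$ is the obstacle set, which the players may not enter), with dynamics $\dot x_p(t)=\alpha u_p(t)$, $\dot x_e(t)=u_e(t)$, $x_p(t_0)=x_{p0}$, $x_e(t_0)=x_{e0}$, where $\alpha>1$. Let $\mathcal{U}_{t_0}$ be the set of piecewise continuous functions $u:[t_0,+\infty)\to\{v\in\mathbb{R}^2:\|v\|=1\}$. $\mathcal{U}^p_{t_0}(x_{p0})\subseteq\mathcal{U}_{t_0}$ (resp. $\mathcal{U}^e_{t_0}(x_{e0})\subseteq\mathcal{U}_{t_0}$) is the set of admissible controls of the pursuer (resp. evader), i.e. those whose trajectory stays in $X$. Write $x_p(t;u_p)$, $x_e(t;u_e)$ for the resulting trajectories. With capture radius $l=0$, the terminal time is $t_f(u_p,u_e)=\inf\{t\ge t_0: x_p(t;u_p)=x_e(t;u_e)\}$, with $\inf\emptyset=+\infty$. Shortest path distance. For $x_1,x_2\in X$, $d_L(x_1,x_2)$ is the infimum of the lengths of continuous, piecewise smooth curves in $X$ joining $x_1$ to $x_2$. Standing assumption: $d_L$ is a (finite) metric on $X$ inducing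 the Euclidean topology of $X$, and for any $x_1,x_2\in X$ there is a piecewise smooth curve in $X$ joining them with length exactly $d_L(x_1,x_2)$ (a shortest path). Dominance region. $\mathcal{D}(x_1,x_2)=\{x\in X: d_L(x,x_1)-\alpha d_L(x,x_2)>0\}$. Reachable region. $\mathcal{R}_e(x_{p0},x_{e0})$ is the set of $x\in X$ for which there exists $u_e\in\mathcal{U}^e_{t_0}(x_{e0})$ such that for all $u_p\in\mathcal{U}^p_{t_0}(x_{p0})$ there exists $t\in[t_0,t_f(u_p,u_e))$ with $x_e(t;u_e)=x$. (It does not depend on $t_0$.) *)

theory Defs
  imports "HOL-Analysis.Analysis"
begin

subsection \<open>Piecewise smooth curves and shortest path distance\<close>

text \<open>
  ``Smooth'' is meant in the sense of calculus: continuously differentiable with nowhere vanishing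
  derivative, up to and including the (one-sided) end points. Without regularity, a piecewise
  \<open>C\<^sup>1\<close> curve may turn infinitely often in finite length, and its unit speed reparametrisation
  would not have a piecewise continuous velocity.
\<close>

definition smooth_arc_on :: "real \<Rightarrow> real \<Rightarrow> (real \<Rightarrow> real^2) \<Rightarrow> bool" where
  "smooth_arc_on a b \<gamma> \<longleftrightarrow> a < b \<and>
     (\<exists>\<gamma>'. continuous_on {a..b} \<gamma>' \<and>
        (\<forall>t\<in>{a..b}. \<gamma>' t \<noteq> 0 \<and> (\<gamma> has_vector_derivative \<gamma>' t) (at t within {a..b})))"

text \<open>
  The number \<open>n\<close> of pieces may be \<open>0\<close>; then \<open>a = b\<close> and the curve is a single point, which is
  the shortest path from a point to itself.
\<close>

definition piecewise_smooth_on :: "real \<Rightarrow> real \<Rightarrow> (real \<Rightarrow> real^2) \<Rightarrow> bool" where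
  "piecewise_smooth_on a b \<gamma> \<longleftrightarrow> continuous_on {a..b} \<gamma> \<and>
     (\<exists>(n::nat) \<tau>. \<tau> 0 = a \<and> \<tau> n = b \<and> (\<forall>i<n. smooth_arc_on (\<tau> i) (\<tau> (Suc i)) \<gamma>))"

definition joins_in ::
  "(real^2) set \<Rightarrow> real^2 \<Rightarrow> real^2 \<Rightarrow> real \<Rightarrow> real \<Rightarrow> (real \<Rightarrow> real^2) \<Rightarrow> bool" where
  "joins_in X x y a b \<gamma> \<longleftrightarrow>
     piecewise_smooth_on a b \<gamma> \<and> \<gamma> ` {a..b} \<subseteq> X \<and> \<gamma> a = x \<and> \<gamma> b = y"

definition curve_length :: "real \<Rightarrow> real \<Rightarrow> (real \<Rightarrow> real^2) \<Rightarrow> real" where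
  "curve_length a b \<gamma> = integral {a..b} (\<lambda>t. norm (vector_derivative \<gamma> (at t)))"

text \<open>
  The value \<open>0\<close> outside \<open>X\<close> is a mere totalisation: the locale \<^locale>\<open>Metric_space\<close> requires
  nonnegativity and symmetry for all arguments, not only for those in the carrier.
\<close>

definition path_dist :: "(real^2) set \<Rightarrow> real^2 \<Rightarrow> real^2 \<Rightarrow> real" where
  "path_dist X x y =
     (if x \<in> X \<and> y \<in> X then Inf {curve_length a b \<gamma> | a b \<gamma>. joins_in X x y a b \<gamma>} else 0)"

text \<open>
  Finiteness of the distance is part of the last conjunct, which makes the set of curve lengths
  nonempty for any two points of \<open>X\<close>.
\<close>

definition shortest_path_region :: "(real^2) set \<Rightarrow> bool" where
  "shortest_path_region X \<longleftrightarrow>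
     Metric_space X (path_dist X) \<and>
     Metric_space.mtopology X (path_dist X) = top_of_set X \<and>
     (\<forall>x\<in>X. \<forall>y\<in>X. \<exists>a b \<gamma>. joins_in X x y a b \<gamma> \<and> curve_length a b \<gamma> = path_dist X x y)"

definition dominance_region ::
  "(real^2) set \<Rightarrow> real \<Rightarrow> real^2 \<Rightarrow> real^2 \<Rightarrow> (real^2) set" where
  "dominance_region X \<alpha> x1 x2 = {x \<in> X. path_dist X x x1 - \<alpha> * path_dist X x x2 > 0}"

subsection \<open>The pursuit-evasion game\<close>

text \<open>
  Finitely many discontinuities in every bounded interval, all of them jumps. Controls are total
  functions of which only the values on \<open>[t0, \<infinity>)\<close> matter.
\<close>

definition piecewise_continuous_from :: "real \<Rightarrow> (real \<Rightarrow> real^2) \<Rightarrow> bool" where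
  "piecewise_continuous_from t0 u \<longleftrightarrow>
     (\<forall>T. finite {t \<in> {t0..T}. \<not> continuous (at t within {t0..}) u}) \<and>
     (\<forall>t>t0. \<exists>v. (u \<longlongrightarrow> v) (at_left t)) \<and>
     (\<forall>t\<ge>t0. \<exists>v. (u \<longlongrightarrow> v) (at_right t))"

definition controls :: "real \<Rightarrow> (real \<Rightarrow> real^2) set" where
  "controls t0 = {u. piecewise_continuous_from t0 u \<and> (\<forall>t\<ge>t0. norm (u t) = 1)}"

text \<open>
  The solution of \<open>x' = c u\<close>, \<open>x(t0) = x0\<close> for a player of speed \<open>c\<close>; as \<open>u\<close> may jump, the
  differential equation is understood in integrated form.
\<close>

definition trajectory ::
  "real \<Rightarrow> real \<Rightarrow> real^2 \<Rightarrow> (real \<Rightarrow> real^2) \<Rightarrow> real \<Rightarrow> real^2" where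
  "trajectory c t0 x0 u t = x0 + c *\<^sub>R integral {t0..t} u"

definition admissible_controls ::
  "(real^2) set \<Rightarrow> real \<Rightarrow> real \<Rightarrow> real^2 \<Rightarrow> (real \<Rightarrow> real^2) set" where
  "admissible_controls X c t0 x0 = {u \<in> controls t0. \<forall>t\<ge>t0. trajectory c t0 x0 u t \<in> X}"

definition terminal_time ::
  "real \<Rightarrow> real \<Rightarrow> real^2 \<Rightarrow> real^2 \<Rightarrow> (real \<Rightarrow> real^2) \<Rightarrow> (real \<Rightarrow> real^2) \<Rightarrow> ereal" where
  "terminal_time \<alpha> t0 xp0 xe0 up ue =
     Inf {ereal t | t. t \<ge> t0 \<and> trajectory \<alpha> t0 xp0 up t = trajectory 1 t0 xe0 ue t}"

definition reachable_region ::
  "(real^2) set \<Rightarrow> real \<Rightarrow> real \<Rightarrow> real^2 \<Rightarrow> real^2 \<Rightarrow> (real^2) set" where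
  "reachable_region X \<alpha> t0 xp0 xe0 =
     {x \<in> X. \<exists>ue \<in> admissible_controls X 1 t0 xe0. \<forall>up \<in> admissible_controls X \<alpha> t0 xp0.
        \<exists>t\<ge>t0. ereal t < terminal_time \<alpha> t0 xp0 xe0 up ue \<and> trajectory 1 t0 xe0 ue t = x}"

end

theory Submission
  imports Defs
begin

text \<open>
  A player of speed \<open>c\<close> covers at most the distance \<open>c (b - a)\<close> during \<open>[a, b]\<close>, and a shortest path
  traversed at unit speed attains this bound. If the evader runs straight to a point \<open>x\<close> of its
  dominance region, a capture on the way would let the pursuer reach \<open>x\<close>, following the evader's
  path after the capture, too early. Conversely, if \<open>x\<close> is not in the dominance region, the pursuer
  can be at \<open>x\<close> no later than the evader's first visit to \<open>x\<close>. As its speed is constant it cannot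
  wait there; instead it walks back along the evader's (known) trajectory and meets the evader.
\<close>

subsection \<open>Walks of constant speed\<close>

text \<open>Distances are defined through piecewise smooth curves in an arbitrary parametrisation,
  trajectories through integrals of controls that may jump. A walk is the common form: it records a
  curve together with its direction, and the one-sided limits of the direction make each piece a
  regular arc up to its end points. The evader commits to its control before the pursuer chooses,
  which is why the pursuer may plan with the whole trajectory of the evader. Controls last forever
  and have norm 1, so a plan that ends at a target must be prolonged by some motion inside the
  region. Pacing along a shortest path between two distinct points supplies it, and the distinct
  initial positions guarantee such points. The same device shows that the pursuer has an admissible
  control at all; otherwise the quantifier over its controls would be vacuous.\<close>

text \<open>
  The control \<open>u\<close> has norm \<open>1\<close> on the whole line, also outside \<open>[a, b]\<close>, so that walks can be joined,
  restricted and reparametrised without side conditions on the values of \<open>u\<close> at the end points.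
\<close>

definition walk ::
  "(real^2) set \<Rightarrow> real \<Rightarrow> real \<Rightarrow> real \<Rightarrow> (real \<Rightarrow> real^2) \<Rightarrow> (real \<Rightarrow> real^2) \<Rightarrow> bool" where
  "walk X c a b g u \<longleftrightarrow> a \<le> b \<and> (\<forall>t. norm (u t) = 1) \<and> continuous_on {a..b} g \<and> g ` {a..b} \<subseteq> X \<and>
     (\<exists>S. finite S \<and>
        (\<forall>t\<in>{a<..<b} - S. isCont u t \<and> (g has_vector_derivative c *\<^sub>R u t) (at t))) \<and>
     (\<forall>t\<in>{a<..b}. \<exists>v. (u \<longlongrightarrow> v) (at_left t)) \<and>
     (\<forall>t\<in>{a..<b}. \<exists>v. (u \<longlongrightarrow> v) (at_right t))"

lemma walkD:
  assumes "walk X c a b g u"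
  shows "a \<le> b" "norm (u t) = 1" "continuous_on {a..b} g" "g ` {a..b} \<subseteq> X"
    "t \<in> {a..b} \<Longrightarrow> g t \<in> X"
    "a < t \<Longrightarrow> t \<le> b \<Longrightarrow> \<exists>v. (u \<longlongrightarrow> v) (at_left t)"
    "a \<le> t \<Longrightarrow> t < b \<Longrightarrow> \<exists>v. (u \<longlongrightarrow> v) (at_right t)"
  using assms by (auto simp: walk_def)

lemma walkE:
  assumes "walk X c a b g u"
  obtains S where "finite S"
    "\<And>t. t \<in> {a<..<b} \<Longrightarrow> t \<notin> S \<Longrightarrow> isCont u t"
    "\<And>t. t \<in> {a<..<b} \<Longrightarrow> t \<notin> S \<Longrightarrow> (g has_vector_derivative c *\<^sub>R u t) (at t)"
  using assms by (auto simp: walk_def)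

text \<open>Derivatives at interior times and one-sided limits see \<open>u\<close> only inside the
  interval. Hence the control may be changed at \<open>a\<close> and \<open>b\<close>, which lets a
  glued control take either value at the joint.\<close>

lemma walk_cong:
  assumes w: "walk X c a b g u"
    and g: "\<And>t. t \<in> {a..b} \<Longrightarrow> g' t = g t"
    and u: "\<And>t. t \<in> {a<..<b} \<Longrightarrow> u' t = u t"
    and n: "\<And>t. norm (u' t) = 1"
  shows "walk X c a b g' u'"
proof -
  obtain S where S: "finite S"
    "\<And>t. t \<in> {a<..<b} \<Longrightarrow> t \<notin> S \<Longrightarrow> isCont u t"
    "\<And>t. t \<in> {a<..<b} \<Longrightarrow> t \<notin> S \<Longrightarrow> (g has_vector_derivative c *\<^sub>R u t) (at t)"
    using walkE[OF w] by metis
  have "isCont u' t \<and> (g' has_vector_derivative c *\<^sub>R u' t) (at t)" if t: "t \<in> {a<..<b}" "t \<notin> S" for t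
  proof
    have "\<forall>\<^sub>F s in nhds t. s \<in> {a<..<b}"
      using t by (intro eventually_nhds_in_open) auto
    then have "\<forall>\<^sub>F s in nhds t. u s = u' s"
      by eventually_elim (simp add: u)
    then show "isCont u' t"
      using S(2)[OF t] isCont_cong by blast
    show "(g' has_vector_derivative c *\<^sub>R u' t) (at t)"
      using has_vector_derivative_transform_within_open[OF S(3)[OF t], of "{a<..<b}" g'] t g
      by (simp add: u)
  qed
  moreover have "\<exists>v. (u' \<longlongrightarrow> v) (at_left t)" if t: "t \<in> {a<..b}" for t
  proof -
    have "\<forall>\<^sub>F s in at_left t. s \<in> {a<..<t}"
      using t by (intro eventually_at_left_real) auto
    then have "\<forall>\<^sub>F s in at_left t. u s = u' s"
      by eventually_elim (use t u in auto)
    then show ?thesis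
      using walkD(6)[OF w, of t] t by (auto cong: tendsto_cong)
  qed
  moreover have "\<exists>v. (u' \<longlongrightarrow> v) (at_right t)" if t: "t \<in> {a..<b}" for t
  proof -
    have "\<forall>\<^sub>F s in at_right t. s \<in> {t<..<b}"
      using t by (intro eventually_at_right_real) auto
    then have "\<forall>\<^sub>F s in at_right t. u s = u' s"
      by eventually_elim (use t u in auto)
    then show ?thesis
      using walkD(7)[OF w, of t] t by (auto cong: tendsto_cong)
  qed
  moreover have "continuous_on {a..b} g'"
    using walkD(3)[OF w] continuous_on_cong[of "{a..b}" "{a..b}" g' g] g by simp
  moreover have "g' ` {a..b} \<subseteq> X"
    using walkD(4)[OF w] g by auto
  ultimately show ?thesis
    unfolding walk_def using S(1) walkD(1)[OF w] n by blast
qed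

lemma walk_combine:
  assumes w1: "walk X c a b g u" and w2: "walk X c b d g u"
  shows "walk X c a d g u"
proof -
  obtain S1 where S1: "finite S1"
    "\<And>t. t \<in> {a<..<b} \<Longrightarrow> t \<notin> S1 \<Longrightarrow> isCont u t"
    "\<And>t. t \<in> {a<..<b} \<Longrightarrow> t \<notin> S1 \<Longrightarrow> (g has_vector_derivative c *\<^sub>R u t) (at t)"
    using walkE[OF w1] by metis
  obtain S2 where S2: "finite S2"
    "\<And>t. t \<in> {b<..<d} \<Longrightarrow> t \<notin> S2 \<Longrightarrow> isCont u t"
    "\<And>t. t \<in> {b<..<d} \<Longrightarrow> t \<notin> S2 \<Longrightarrow> (g has_vector_derivative c *\<^sub>R u t) (at t)"
    using walkE[OF w2] by metis
  have ab: "a \<le> b" and bd: "b \<le> d" using walkD(1) w1 w2 by auto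
  then have un: "{a..d} = {a..b} \<union> {b..d}" by auto
  have "continuous_on {a..d} g"
    unfolding un using walkD(3)[OF w1] walkD(3)[OF w2] by (intro continuous_on_closed_Un) auto
  moreover have "g ` {a..d} \<subseteq> X"
    unfolding un using walkD(4)[OF w1] walkD(4)[OF w2] by blast
  moreover have "\<exists>S. finite S \<and>
      (\<forall>t\<in>{a<..<d} - S. isCont u t \<and> (g has_vector_derivative c *\<^sub>R u t) (at t))"
  proof (intro exI conjI ballI)
    \<comment> \<open>The joint becomes exceptional: direction and derivative are known there from
      one side at a time.\<close>
    show "finite (insert b (S1 \<union> S2))" using S1(1) S2(1) by simp
    fix t assume t: "t \<in> {a<..<d} - insert b (S1 \<union> S2)"
    then show "isCont u t"
      using S1(2)[of t] S2(2)[of t] by (cases "t < b") auto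
    show "(g has_vector_derivative c *\<^sub>R u t) (at t)"
      using t S1(3)[of t] S2(3)[of t] by (cases "t < b") auto
  qed
  moreover have "\<exists>v. (u \<longlongrightarrow> v) (at_left t)" if "t \<in> {a<..d}" for t
    using that walkD(6)[OF w1, of t] walkD(6)[OF w2, of t] by fastforce
  moreover have "\<exists>v. (u \<longlongrightarrow> v) (at_right t)" if "t \<in> {a..<d}" for t
    using that walkD(7)[OF w1, of t] walkD(7)[OF w2, of t] by fastforce
  ultimately show ?thesis
    unfolding walk_def using ab bd walkD(2)[OF w1] by auto
qed

lemma walk_join:
  assumes w1: "walk X c a b g1 u1" and w2: "walk X c b d g2 u2" and eq: "g1 b = g2 b"
  shows "walk X c a d (\<lambda>t. if t \<le> b then g1 t else g2 t) (\<lambda>t. if t < b then u1 t else u2 t)"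
proof (rule walk_combine)
  show "walk X c a b (\<lambda>t. if t \<le> b then g1 t else g2 t) (\<lambda>t. if t < b then u1 t else u2 t)"
    by (rule walk_cong[OF w1]) (use walkD(2)[OF w1] walkD(2)[OF w2] in auto)
  show "walk X c b d (\<lambda>t. if t \<le> b then g1 t else g2 t) (\<lambda>t. if t < b then u1 t else u2 t)"
    by (rule walk_cong[OF w2]) (use walkD(2)[OF w1] walkD(2)[OF w2] eq in auto)
qed

lemma walk_subinterval:
  assumes w: "walk X c a b g u" and "a \<le> a'" "a' \<le> b'" "b' \<le> b"
  shows "walk X c a' b' g u"
proof -
  obtain S where S: "finite S"
    "\<And>t. t \<in> {a<..<b} \<Longrightarrow> t \<notin> S \<Longrightarrow> isCont u t"
    "\<And>t. t \<in> {a<..<b} \<Longrightarrow> t \<notin> S \<Longrightarrow> (g has_vector_derivative c *\<^sub>R u t) (at t)"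
    using walkE[OF w] by metis
  have "continuous_on {a'..b'} g"
    by (rule continuous_on_subset[OF walkD(3)[OF w]]) (use assms in auto)
  moreover have "g ` {a'..b'} \<subseteq> X"
    using walkD(4)[OF w] assms by auto
  moreover have "\<forall>t\<in>{a'<..<b'} - S. isCont u t \<and> (g has_vector_derivative c *\<^sub>R u t) (at t)"
    using S assms by auto
  ultimately show ?thesis
    unfolding walk_def using assms S(1) walkD(2)[OF w] walkD(6,7)[OF w] by auto
qed

text \<open>With \<open>k = 1\<close> this shifts time; with \<open>k = \<alpha>\<close> it turns a
  walk of speed 1 into one the pursuer can perform.\<close>

lemma walk_rescale:
  assumes w: "walk X c (m + k * a) (m + k * b) g u" and k: "k > 0"
  shows "walk X (c * k) a b (\<lambda>t. g (m + k * t)) (\<lambda>t. u (m + k * t))"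
proof -
  let ?f = "\<lambda>t. m + k * t"
  obtain S where S: "finite S"
    "\<And>t. t \<in> {?f a<..<?f b} \<Longrightarrow> t \<notin> S \<Longrightarrow> isCont u t"
    "\<And>t. t \<in> {?f a<..<?f b} \<Longrightarrow> t \<notin> S \<Longrightarrow> (g has_vector_derivative c *\<^sub>R u t) (at t)"
    using walkE[OF w] by metis
  have inj: "inj ?f" using k by (auto simp: inj_def)
  have "continuous_on {a..b} (\<lambda>t. g (?f t))"
    by (rule continuous_on_compose2[OF walkD(3)[OF w]]) (use k in \<open>auto intro!: continuous_intros\<close>)
  moreover have "(\<lambda>t. g (?f t)) ` {a..b} \<subseteq> X"
    using walkD(4)[OF w] k by (auto simp: image_subset_iff)
  moreover have "isCont (\<lambda>t. u (?f t)) t \<and>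
      ((\<lambda>t. g (?f t)) has_vector_derivative (c * k) *\<^sub>R u (?f t)) (at t)"
    if t: "t \<in> {a<..<b} - ?f -` S" for t
  proof
    have t': "?f t \<in> {?f a<..<?f b}" "?f t \<notin> S" using t k by auto
    show "isCont (\<lambda>t. u (?f t)) t"
      by (rule isCont_o2[where f = ?f and g = u]) (use S(2)[OF t'] in \<open>auto intro!: continuous_intros\<close>)
    have "(?f has_vector_derivative k) (at t)"
      by (auto intro!: derivative_eq_intros simp: has_real_derivative_iff_has_vector_derivative[symmetric])
    from vector_diff_chain_at[OF this S(3)[OF t']]
    show "((\<lambda>t. g (?f t)) has_vector_derivative (c * k) *\<^sub>R u (?f t)) (at t)"
      by (simp add: o_def mult.commute)
  qed
  moreover have "finite (?f -` S)" using S(1) inj by (rule finite_vimageI)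
  moreover have "\<exists>v. ((\<lambda>t. u (?f t)) \<longlongrightarrow> v) (at_left t)" if t: "t \<in> {a<..b}" for t
  proof -
    have "filterlim ?f (at_left (?f t)) (at_left t)"
      unfolding filterlim_at
      using k by (auto simp: eventually_at_filter intro!: tendsto_intros always_eventually)
    moreover obtain v where "(u \<longlongrightarrow> v) (at_left (?f t))"
      using walkD(6)[OF w, of "?f t"] t k by auto
    ultimately show ?thesis using filterlim_compose by blast
  qed
  moreover have "\<exists>v. ((\<lambda>t. u (?f t)) \<longlongrightarrow> v) (at_right t)" if t: "t \<in> {a..<b}" for t
  proof -
    have "filterlim ?f (at_right (?f t)) (at_right t)"
      unfolding filterlim_at
      using k by (auto simp: eventually_at_filter intro!: tendsto_intros always_eventually)
    moreover obtain v where "(u \<longlongrightarrow> v) (at_right (?f t))"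
      using walkD(7)[OF w, of "?f t"] t k by auto
    ultimately show ?thesis using filterlim_compose by blast
  qed
  moreover have "a \<le> b" using walkD(1)[OF w] k by simp
  ultimately show ?thesis
    unfolding walk_def using walkD(2)[OF w] by blast
qed

text \<open>Reversal of time exchanges left and right limits, which is one reason why walks demand
  both.\<close>

lemma walk_reverse:
  assumes w: "walk X c (m - b) (m - a) g u"
  shows "walk X c a b (\<lambda>t. g (m - t)) (\<lambda>t. - u (m - t))"
proof -
  let ?f = "\<lambda>t. m - t"
  obtain S where S: "finite S"
    "\<And>t. t \<in> {?f b<..<?f a} \<Longrightarrow> t \<notin> S \<Longrightarrow> isCont u t"
    "\<And>t. t \<in> {?f b<..<?f a} \<Longrightarrow> t \<notin> S \<Longrightarrow> (g has_vector_derivative c *\<^sub>R u t) (at t)"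
    using walkE[OF w] by metis
  have inj: "inj ?f" by (auto simp: inj_def)
  have "continuous_on {a..b} (\<lambda>t. g (?f t))"
    by (rule continuous_on_compose2[OF walkD(3)[OF w]]) (auto intro!: continuous_intros)
  moreover have "(\<lambda>t. g (?f t)) ` {a..b} \<subseteq> X"
    using walkD(4)[OF w] by (auto simp: image_subset_iff)
  moreover have "isCont (\<lambda>t. - u (?f t)) t \<and>
      ((\<lambda>t. g (?f t)) has_vector_derivative c *\<^sub>R (- u (?f t))) (at t)"
    if t: "t \<in> {a<..<b} - ?f -` S" for t
  proof
    have t': "?f t \<in> {?f b<..<?f a}" "?f t \<notin> S" using t by auto
    have "isCont (\<lambda>t. u (?f t)) t"
      by (rule isCont_o2[where f = ?f and g = u]) (use S(2)[OF t'] in \<open>auto intro!: continuous_intros\<close>)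
    then show "isCont (\<lambda>t. - u (?f t)) t" by (intro continuous_intros)
    have "(?f has_vector_derivative -1) (at t)"
      by (auto intro!: derivative_eq_intros simp: has_real_derivative_iff_has_vector_derivative[symmetric])
    from vector_diff_chain_at[OF this S(3)[OF t']]
    show "((\<lambda>t. g (?f t)) has_vector_derivative c *\<^sub>R (- u (?f t))) (at t)"
      by (simp add: o_def)
  qed
  moreover have "finite (?f -` S)" using S(1) inj by (rule finite_vimageI)
  moreover have "\<exists>v. ((\<lambda>t. - u (?f t)) \<longlongrightarrow> v) (at_left t)" if t: "t \<in> {a<..b}" for t
  proof -
    have "filterlim ?f (at_right (?f t)) (at_left t)"
      unfolding filterlim_at
      by (auto simp: eventually_at_filter intro!: tendsto_intros always_eventually)
    moreover obtain v where "(u \<longlongrightarrow> v) (at_right (?f t))"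
      using walkD(7)[OF w, of "?f t"] t by auto
    ultimately show ?thesis using filterlim_compose tendsto_minus by blast
  qed
  moreover have "\<exists>v. ((\<lambda>t. - u (?f t)) \<longlongrightarrow> v) (at_right t)" if t: "t \<in> {a..<b}" for t
  proof -
    have "filterlim ?f (at_left (?f t)) (at_right t)"
      unfolding filterlim_at
      by (auto simp: eventually_at_filter intro!: tendsto_intros always_eventually)
    moreover obtain v where "(u \<longlongrightarrow> v) (at_left (?f t))"
      using walkD(6)[OF w, of "?f t"] t by auto
    ultimately show ?thesis using filterlim_compose tendsto_minus by blast
  qed
  moreover have "a \<le> b" using walkD(1)[OF w] by simp
  ultimately show ?thesis
    unfolding walk_def norm_minus_cancel using walkD(2)[OF w] by blast
qed

subsection \<open>Walks as piecewise smooth curves\<close>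

lemma piecewise_smooth_on_smooth_arc:
  assumes "smooth_arc_on a b \<gamma>" "continuous_on {a..b} \<gamma>"
  shows "piecewise_smooth_on a b \<gamma>"
  unfolding piecewise_smooth_on_def using assms
  by (auto intro!: exI[of _ "Suc 0"] exI[of _ "\<lambda>i. if i = 0 then a else b"])

lemma smooth_arcs_le:
  fixes \<tau> :: "nat \<Rightarrow> real"
  assumes "\<forall>i<n. smooth_arc_on (\<tau> i) (\<tau> (Suc i)) \<gamma>"
  shows "\<tau> 0 \<le> \<tau> n"
  using assms
proof (induction n)
  case (Suc n)
  then have "\<tau> 0 \<le> \<tau> n" "\<tau> n < \<tau> (Suc n)"
    by (auto simp: smooth_arc_on_def)
  then show ?case by simp
qed simp

lemma piecewise_smooth_on_le: "piecewise_smooth_on a b \<gamma> \<Longrightarrow> a \<le> b"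
  unfolding piecewise_smooth_on_def using smooth_arcs_le by blast

lemma piecewise_smooth_on_combine:
  assumes "piecewise_smooth_on a b \<gamma>" "piecewise_smooth_on b c \<gamma>"
  shows "piecewise_smooth_on a c \<gamma>"
proof -
  obtain n \<sigma> where \<sigma>: "\<sigma> 0 = a" "\<sigma> n = b" "\<And>i. i < n \<Longrightarrow> smooth_arc_on (\<sigma> i) (\<sigma> (Suc i)) \<gamma>"
    using assms(1) unfolding piecewise_smooth_on_def by blast
  obtain m \<tau> where \<tau>: "\<tau> 0 = b" "\<tau> m = c" "\<And>i. i < m \<Longrightarrow> smooth_arc_on (\<tau> i) (\<tau> (Suc i)) \<gamma>"
    using assms(2) unfolding piecewise_smooth_on_def by blast
  have "a \<le> b" "b \<le> c" using assms piecewise_smooth_on_le by auto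
  then have "{a..c} = {a..b} \<union> {b..c}" by auto
  then have "continuous_on {a..c} \<gamma>"
    using assms unfolding piecewise_smooth_on_def by (auto intro: continuous_on_closed_Un)
  \<comment> \<open>The joint is listed once: index \<open>n\<close> yields
    \<open>\<sigma> n\<close>, which equals \<open>\<tau> 0\<close>.\<close>
  moreover define \<rho> where "\<rho> i = (if i \<le> n then \<sigma> i else \<tau> (i - n))" for i
  have "\<rho> 0 = a" "\<rho> (n + m) = c"
    using \<sigma> \<tau> by (auto simp: \<rho>_def)
  moreover have "smooth_arc_on (\<rho> i) (\<rho> (Suc i)) \<gamma>" if "i < n + m" for i
  proof -
    consider "i < n" | "i = n" | "i > n" by linarith
    then show ?thesis
    proof cases
      case 3
      then show ?thesis using that \<tau>(3)[of "i - n"] by (simp add: \<rho>_def Suc_diff_le)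
    qed (use that \<sigma>(2,3) \<tau>(1) \<tau>(3)[of 0] in \<open>auto simp: \<rho>_def\<close>)
  qed
  ultimately show ?thesis unfolding piecewise_smooth_on_def by blast
qed

text \<open>Replacing the end values of \<open>u\<close> by its one-sided limits gives a direction
  continuous on the closed interval. The limits still have norm 1, so the derivative does not
  vanish, and \<open>g\<close> is an integral of this direction, so it is differentiable up to the
  end points.\<close>

lemma walk_smooth_arc:
  assumes w: "walk X c a b g u" and "a < b" "c \<noteq> 0"
    and cont: "\<And>t. t \<in> {a<..<b} \<Longrightarrow> isCont u t"
    and der: "\<And>t. t \<in> {a<..<b} \<Longrightarrow> (g has_vector_derivative c *\<^sub>R u t) (at t)"
  shows "smooth_arc_on a b g"
proof -
  obtain va vb where va: "(u \<longlongrightarrow> va) (at_right a)" and vb: "(u \<longlongrightarrow> vb) (at_left b)"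
    using walkD(6)[OF w, of b] walkD(7)[OF w, of a] \<open>a < b\<close> by auto
  have nva: "norm va = 1"
    using tendsto_norm[OF va] walkD(2)[OF w]
    by (simp add: tendsto_const_iff)
  have nvb: "norm vb = 1"
    using tendsto_norm[OF vb] walkD(2)[OF w]
    by (simp add: tendsto_const_iff)
  define v where "v t = (if t = a then va else if t = b then vb else u t)" for t
  have vu: "v t = u t" if "t \<in> {a<..<b}" for t using that by (auto simp: v_def)
  have v: "continuous_on {a..b} v"
  proof (rule continuous_on_IccI)
    have "\<forall>\<^sub>F s in at_right a. s \<in> {a<..<b}"
      using \<open>a < b\<close> by (intro eventually_at_right_real)
    then have "\<forall>\<^sub>F s in at_right a. u s = v s" by eventually_elim (simp add: vu)
    then show "(v \<longlongrightarrow> v a) (at_right a)"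
      using tendsto_cong[THEN iffD1, OF _ va] by (simp add: v_def)
    have "\<forall>\<^sub>F s in at_left b. s \<in> {a<..<b}"
      using \<open>a < b\<close> by (intro eventually_at_left_real)
    then have "\<forall>\<^sub>F s in at_left b. u s = v s" by eventually_elim (simp add: vu)
    then show "(v \<longlongrightarrow> v b) (at_left b)"
      using tendsto_cong[THEN iffD1, OF _ vb] \<open>a < b\<close> by (simp add: v_def)
    fix t assume t: "a < t" "t < b"
    then have "\<forall>\<^sub>F s in nhds t. s \<in> {a<..<b}"
      by (intro eventually_nhds_in_open) auto
    then have "\<forall>\<^sub>F s in nhds t. u s = v s" by eventually_elim (simp add: vu)
    then have "isCont v t" using isCont_cong[THEN iffD1, OF _ cont] t by simp
    then show "v \<midarrow>t\<rightarrow> v t" by (simp add: isCont_def)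
  qed fact
  have g: "g t = g a + c *\<^sub>R integral {a..t} v" if t: "t \<in> {a..b}" for t
  proof -
    have "((\<lambda>s. c *\<^sub>R v s) has_integral (g t - g a)) {a..t}"
    proof (rule fundamental_theorem_of_calculus_interior)
      show "continuous_on {a..t} g"
        by (rule continuous_on_subset[OF walkD(3)[OF w]]) (use t in auto)
    qed (use t der vu in auto)
    from integral_unique[OF this] show ?thesis by (simp add: algebra_simps)
  qed
  have "(g has_vector_derivative c *\<^sub>R v t) (at t within {a..b})" if t: "t \<in> {a..b}" for t
  proof (rule has_vector_derivative_transform[OF t g])
    have "((\<lambda>t. c *\<^sub>R integral {a..t} v) has_vector_derivative c *\<^sub>R v t) (at t within {a..b})"
      by (intro bounded_linear.has_vector_derivative[OF bounded_linear_scaleR_right]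
          integral_has_vector_derivative v t)
    from has_vector_derivative_add[OF has_vector_derivative_const this]
    show "((\<lambda>t. g a + c *\<^sub>R integral {a..t} v) has_vector_derivative c *\<^sub>R v t) (at t within {a..b})"
      by simp
  qed
  moreover have "v t \<noteq> 0" for t
    using nva nvb walkD(2)[OF w, of t] by (auto simp: v_def)
  ultimately show ?thesis
    unfolding smooth_arc_on_def using \<open>a < b\<close> \<open>c \<noteq> 0\<close> v
    by (auto intro!: exI[of _ "\<lambda>t. c *\<^sub>R v t"] continuous_intros)
qed

lemma walk_piecewise_smooth:
  assumes "walk X c a b g u" "c \<noteq> 0"
  shows "piecewise_smooth_on a b g"
proof -
  obtain S where S: "finite S"
    "\<And>t. t \<in> {a<..<b} \<Longrightarrow> t \<notin> S \<Longrightarrow> isCont u t"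
    "\<And>t. t \<in> {a<..<b} \<Longrightarrow> t \<notin> S \<Longrightarrow> (g has_vector_derivative c *\<^sub>R u t) (at t)"
    using walkE[OF assms(1)] by metis
  then show ?thesis using assms(1)
  \<comment> \<open>The interval is cut at one exceptional time after the other; times outside the
    current interval are simply dropped.\<close>
  proof (induction S arbitrary: a b)
    case empty
    then have "a \<le> b" using walkD(1) by blast
    then consider "a = b" | "a < b" by linarith
    then show ?case
    proof cases
      case 1
      then show ?thesis unfolding piecewise_smooth_on_def by (auto intro: exI[of _ "0::nat"])
    next
      case 2
      then show ?thesis
        using empty walk_smooth_arc \<open>c \<noteq> 0\<close> walkD(3)
        by (intro piecewise_smooth_on_smooth_arc) auto
    qed
  next
    case (insert s S)
    show ?case
    proof (cases "s \<in> {a<..<b}")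
      case True
      have "piecewise_smooth_on a s g"
        using True insert.prems walk_subinterval[OF insert.prems(3), of a s]
        by (intro insert.IH) auto
      moreover have "piecewise_smooth_on s b g"
        using True insert.prems walk_subinterval[OF insert.prems(3), of s b]
        by (intro insert.IH) auto
      ultimately show ?thesis by (rule piecewise_smooth_on_combine)
    next
      case False
      then show ?thesis
        using insert.prems by (intro insert.IH) auto
    qed
  qed
qed

lemma walk_curve_length:
  assumes w: "walk X c a b g u" and "c \<ge> 0"
  shows "curve_length a b g = c * (b - a)"
proof -
  obtain S where S: "finite S"
    "\<And>t. t \<in> {a<..<b} \<Longrightarrow> t \<notin> S \<Longrightarrow> (g has_vector_derivative c *\<^sub>R u t) (at t)"
    using walkE[OF w] by metis
  have "curve_length a b g = integral {a..b} (\<lambda>t. c)"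
    unfolding curve_length_def
  proof (rule integral_spike)
    show "negligible (insert a (insert b S))" using S(1) by (intro negligible_finite) simp
    fix t assume "t \<in> {a..b} - insert a (insert b S)"
    then have "(g has_vector_derivative c *\<^sub>R u t) (at t)" by (intro S) auto
    then show "c = norm (vector_derivative g (at t))"
      using vector_derivative_at walkD(2)[OF w, of t] \<open>c \<ge> 0\<close> by fastforce
  qed
  then show ?thesis using walkD(1)[OF w] by simp
qed

lemma curve_length_nonneg: "0 \<le> curve_length a b \<gamma>"
  unfolding curve_length_def
  \<comment> \<open>A non-integrable function has integral 0 by convention, so the curve needs no
    regularity.\<close>
  by (cases "(\<lambda>t. norm (vector_derivative \<gamma> (at t))) integrable_on {a..b}")
    (auto intro: integral_nonneg simp: not_integrable_integral)

lemma path_dist_le_curve_length: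
  assumes "joins_in X x y a b \<gamma>" "x \<in> X" "y \<in> X"
  shows "path_dist X x y \<le> curve_length a b \<gamma>"
proof -
  have "bdd_below {curve_length a b \<gamma> | a b \<gamma>. joins_in X x y a b \<gamma>}"
    by (rule bdd_belowI[of _ 0]) (auto intro: curve_length_nonneg)
  then show ?thesis
    unfolding path_dist_def using assms by (auto intro: cInf_lower)
qed

text \<open>Every lower bound on travel time comes from here, for the pursuer as well as for the
  evader.\<close>

lemma walk_path_dist:
  assumes w: "walk X c a b g u" and "c > 0"
  shows "path_dist X (g a) (g b) \<le> c * (b - a)"
proof -
  have "joins_in X (g a) (g b) a b g"
    unfolding joins_in_def using walk_piecewise_smooth[OF w] walkD(4)[OF w] \<open>c > 0\<close> by simp
  then have "path_dist X (g a) (g b) \<le> curve_length a b g"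
    using walkD(5)[OF w] walkD(1)[OF w] by (intro path_dist_le_curve_length) auto
  then show ?thesis using walk_curve_length[OF w] \<open>c > 0\<close> by simp
qed

subsection \<open>Unit speed parametrisation of shortest paths\<close>

text \<open>Parametrisation by arc length: \<open>s\<close> is strictly increasing because the
  derivative never vanishes, and the unit tangent along its inverse \<open>h\<close> is continuous
  up to the end points, so it has the required limits. The length is given by
  \<open>has_integral\<close> so that integrability is available when pieces are added.\<close>

lemma smooth_arc_walk:
  assumes arc: "smooth_arc_on a b \<gamma>" and sub: "\<gamma> ` {a..b} \<subseteq> X"
  shows "\<exists>l g u. walk X 1 0 l g u \<and> g 0 = \<gamma> a \<and> g l = \<gamma> b \<and>
    ((\<lambda>t. norm (vector_derivative \<gamma> (at t))) has_integral l) {a..b}"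
proof -
  obtain \<gamma>' where "a < b" and \<gamma>': "continuous_on {a..b} \<gamma>'"
    and nz: "\<And>t. t \<in> {a..b} \<Longrightarrow> \<gamma>' t \<noteq> 0"
    and der: "\<And>t. t \<in> {a..b} \<Longrightarrow> (\<gamma> has_vector_derivative \<gamma>' t) (at t within {a..b})"
    using arc unfolding smooth_arc_on_def by blast
  have derI: "(\<gamma> has_vector_derivative \<gamma>' t) (at t)" if "t \<in> {a<..<b}" for t
    using der[of t] that by (simp add: at_within_Icc_at)
  have \<gamma>: "continuous_on {a..b} \<gamma>"
    using der by (intro continuous_on_vector_derivative)
  define s where "s t = integral {a..t} (\<lambda>t. norm (\<gamma>' t))" for t
  have speed: "continuous_on {a..b} (\<lambda>t. norm (\<gamma>' t))"
    by (intro continuous_intros \<gamma>')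
  have sder: "(s has_real_derivative norm (\<gamma>' t)) (at t within {a..b})" if "t \<in> {a..b}" for t
    unfolding s_def using integral_has_vector_derivative[OF speed that]
    by (simp add: has_real_derivative_iff_has_vector_derivative)
  have sderI: "(s has_real_derivative norm (\<gamma>' t)) (at t)" if "t \<in> {a<..<b}" for t
    using sder[of t] that by (simp add: at_within_Icc_at)
  have s: "continuous_on {a..b} s"
    using sder by (intro DERIV_continuous_on)
  have smono: "s t1 < s t2" if "a \<le> t1" "t1 < t2" "t2 \<le> b" for t1 t2
  proof (rule DERIV_pos_imp_increasing_open[OF \<open>t1 < t2\<close>])
    show "\<exists>y. (s has_real_derivative y) (at t) \<and> 0 < y" if "t1 < t" "t < t2" for t
      using that \<open>a \<le> t1\<close> \<open>t2 \<le> b\<close> sderI[of t] nz[of t] by (intro exI[of _ "norm (\<gamma>' t)"]) auto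
    show "continuous_on {t1..t2} s"
      by (rule continuous_on_subset[OF s]) (use that in auto)
  qed
  have inj: "inj_on s {a..b}"
  proof (rule inj_onI)
    fix t1 t2 assume *: "t1 \<in> {a..b}" "t2 \<in> {a..b}" "s t1 = s t2"
    show "t1 = t2"
      using smono[of t1 t2] smono[of t2 t1] * by (cases t1 t2 rule: linorder_cases) auto
  qed
  have s0: "s a = 0" by (simp add: s_def)
  define l where "l = s b"
  have l: "0 < l" using smono[of a b] \<open>a < b\<close> by (simp add: l_def s0)
  have im: "s ` {a..b} = {0..l}"
  proof
    show "s ` {a..b} \<subseteq> {0..l}"
    proof
      fix y assume "y \<in> s ` {a..b}"
      then obtain t where "t \<in> {a..b}" "y = s t" by blast
      then show "y \<in> {0..l}"
        using smono[of a t] smono[of t b] s0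
        by (cases "t = a"; cases "t = b") (auto simp: l_def)
    qed
    show "{0..l} \<subseteq> s ` {a..b}"
    proof
      fix y assume "y \<in> {0..l}"
      then show "y \<in> s ` {a..b}"
        using IVT'[of s a y b] s \<open>a < b\<close> s0 by (auto simp: l_def)
    qed
  qed
  define h where "h = the_inv_into {a..b} s"
  have sh: "s (h y) = y" if "y \<in> {0..l}" for y
    unfolding h_def using that im by (intro f_the_inv_into_f[OF inj]) auto
  have hs: "h (s t) = t" if "t \<in> {a..b}" for t
    unfolding h_def using that by (intro the_inv_into_f_f[OF inj])
  have hab: "h y \<in> {a..b}" if "y \<in> {0..l}" for y
    using that im hs by (metis imageE)
  have h0: "h 0 = a" and hl: "h l = b"
    using hs[of a] hs[of b] \<open>a < b\<close> by (auto simp: s0 l_def)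
  have hI: "h y \<in> {a<..<b}" if "y \<in> {0<..<l}" for y
  proof -
    have "h y \<noteq> a" "h y \<noteq> b" using sh[of y] that s0 by (auto simp: l_def)
    then show ?thesis using hab[of y] that by auto
  qed
  have h: "continuous_on {0..l} h"
    using continuous_on_inv_into[OF s _ inj] by (simp add: im h_def)
  define v where "v y = sgn (\<gamma>' (h y))" for y
  have v: "continuous_on {0..l} v"
    unfolding v_def sgn_div_norm using nz hab
    by (auto intro!: continuous_intros continuous_on_compose2[OF \<gamma>' h])
  \<comment> \<open>Beyond the arc any unit vector will do; walks ask for norm 1 on the whole
    line.\<close>
  define u where "u y = (if y \<in> {0..l} then v y else axis 1 1)" for y
  have nu: "norm (u y) = 1" for y
    using nz hab by (auto simp: u_def v_def norm_sgn)
  have u: "continuous_on {0..l} u"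
    using v by (rule continuous_on_eq) (simp add: u_def)
  have gder: "((\<lambda>y. \<gamma> (h y)) has_vector_derivative 1 *\<^sub>R u y) (at y)" if y: "y \<in> {0<..<l}" for y
  proof -
    have "(h has_real_derivative inverse (norm (\<gamma>' (h y)))) (at y)"
    proof (rule DERIV_inverse_function[where f = s and a = 0 and b = l])
      show "(s has_real_derivative norm (\<gamma>' (h y))) (at (h y))"
        using hI[OF y] by (rule sderI)
      show "isCont h y"
        using continuous_on_interior[OF h] y by simp
    qed (use y nz hab sh in auto)
    then have "(h has_vector_derivative inverse (norm (\<gamma>' (h y)))) (at y)"
      by (simp add: has_real_derivative_iff_has_vector_derivative)
    from vector_diff_chain_at[OF this derI[OF hI[OF y]]]
    show ?thesis using y by (simp add: o_def u_def v_def sgn_div_norm divide_inverse)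
  qed
  have "walk X 1 0 l (\<lambda>y. \<gamma> (h y)) u"
    unfolding walk_def
  proof (intro conjI)
    show "continuous_on {0..l} (\<lambda>y. \<gamma> (h y))"
      by (rule continuous_on_compose2[OF \<gamma> h]) (use hab in auto)
    show "(\<lambda>y. \<gamma> (h y)) ` {0..l} \<subseteq> X"
      using sub hab by auto
    have "isCont u y" if "y \<in> {0<..<l}" for y
      using continuous_on_interior[OF u] that by simp
    then show "\<exists>S. finite S \<and> (\<forall>y\<in>{0<..<l} - S. isCont u y \<and>
        ((\<lambda>y. \<gamma> (h y)) has_vector_derivative 1 *\<^sub>R u y) (at y))"
      using gder by (intro exI[of _ "{}"]) auto
    show "\<forall>y\<in>{0<..l}. \<exists>v. (u \<longlongrightarrow> v) (at_left y)"
    proof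
      fix y assume "y \<in> {0<..l}"
      then have "continuous_on {0..y} u" "0 < y"
        by (auto intro: continuous_on_subset[OF u])
      then show "\<exists>v. (u \<longlongrightarrow> v) (at_left y)" using continuous_on_Icc_at_leftD by blast
    qed
    show "\<forall>y\<in>{0..<l}. \<exists>v. (u \<longlongrightarrow> v) (at_right y)"
    proof
      fix y assume "y \<in> {0..<l}"
      then have "continuous_on {y..l} u" "y < l"
        by (auto intro: continuous_on_subset[OF u])
      then show "\<exists>v. (u \<longlongrightarrow> v) (at_right y)" using continuous_on_Icc_at_rightD by blast
    qed
  qed (use l nu in auto)
  moreover have "((\<lambda>t. norm (vector_derivative \<gamma> (at t))) has_integral l) {a..b}"
  \<comment> \<open>The length uses two-sided derivatives, which the arc does not determine at
    \<open>a\<close> and \<open>b\<close>.\<close>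
  proof (rule has_integral_spike_finite)
    show "((\<lambda>t. norm (\<gamma>' t)) has_integral l) {a..b}"
      unfolding l_def s_def using integrable_continuous_real[OF speed] by (rule integrable_integral)
    show "norm (vector_derivative \<gamma> (at t)) = norm (\<gamma>' t)" if "t \<in> {a..b} - {a, b}" for t
      using vector_derivative_at[OF derI, of t] that by simp
  qed simp
  moreover have "(\<lambda>y. \<gamma> (h y)) 0 = \<gamma> a" "(\<lambda>y. \<gamma> (h y)) l = \<gamma> b" using h0 hl by auto
  ultimately show ?thesis by blast
qed

lemma smooth_arcs_walk:
  fixes \<tau> :: "nat \<Rightarrow> real"
  assumes "\<forall>i<n. smooth_arc_on (\<tau> i) (\<tau> (Suc i)) \<gamma>" and "\<gamma> ` {\<tau> 0..\<tau> n} \<subseteq> X"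
  shows "\<exists>l g u. walk X 1 0 l g u \<and> g 0 = \<gamma> (\<tau> 0) \<and> g l = \<gamma> (\<tau> n) \<and>
    ((\<lambda>t. norm (vector_derivative \<gamma> (at t))) has_integral l) {\<tau> 0..\<tau> n}"
  using assms
proof (induction n)
  case 0
  show ?case
  proof (intro exI conjI)
    \<comment> \<open>The walk of duration 0 is the shortest path from a point to itself.\<close>
    show "walk X 1 0 0 (\<lambda>t. \<gamma> (\<tau> 0)) (\<lambda>t. axis 1 1)"
      using 0 by (auto simp: walk_def)
  qed auto
next
  case (Suc n)
  have le: "\<tau> 0 \<le> \<tau> n" "\<tau> n \<le> \<tau> (Suc n)"
    using smooth_arcs_le[of n \<tau> \<gamma>] Suc.prems(1) by (auto simp: smooth_arc_on_def less_imp_le)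
  have "\<gamma> ` {\<tau> 0..\<tau> n} \<subseteq> X" "\<gamma> ` {\<tau> n..\<tau> (Suc n)} \<subseteq> X"
    using Suc.prems(2) le by auto
  moreover have "smooth_arc_on (\<tau> n) (\<tau> (Suc n)) \<gamma>" using Suc.prems(1) by simp
  ultimately obtain l1 g1 u1 l2 g2 u2 where
    1: "walk X 1 0 l1 g1 u1" "g1 0 = \<gamma> (\<tau> 0)" "g1 l1 = \<gamma> (\<tau> n)"
      "((\<lambda>t. norm (vector_derivative \<gamma> (at t))) has_integral l1) {\<tau> 0..\<tau> n}" and
    2: "walk X 1 0 l2 g2 u2" "g2 0 = \<gamma> (\<tau> n)" "g2 l2 = \<gamma> (\<tau> (Suc n))"
      "((\<lambda>t. norm (vector_derivative \<gamma> (at t))) has_integral l2) {\<tau> n..\<tau> (Suc n)}"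
    using Suc.IH Suc.prems(1) smooth_arc_walk[of "\<tau> n" "\<tau> (Suc n)" \<gamma> X] by auto
  have "0 \<le> l1" "0 \<le> l2" using 1 2 walkD(1) by auto
  have "walk X 1 l1 (l1 + l2) (\<lambda>t. g2 (- l1 + 1 * t)) (\<lambda>t. u2 (- l1 + 1 * t))"
    using walk_rescale[of X 1 "- l1" 1 l1 "l1 + l2" g2 u2] 2(1) by simp
  from walk_join[OF 1(1) this]
  have "walk X 1 0 (l1 + l2) (\<lambda>t. if t \<le> l1 then g1 t else g2 (- l1 + 1 * t))
      (\<lambda>t. if t < l1 then u1 t else u2 (- l1 + 1 * t))" (is "walk X 1 0 _ ?g _")
    using 1 2 by simp
  moreover have "((\<lambda>t. norm (vector_derivative \<gamma> (at t))) has_integral (l1 + l2)) {\<tau> 0..\<tau> (Suc n)}"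
    using has_integral_combine[OF le 1(4) 2(4)] .
  moreover have "?g 0 = \<gamma> (\<tau> 0)" "?g (l1 + l2) = \<gamma> (\<tau> (Suc n))"
    using 1 2 \<open>0 \<le> l1\<close> \<open>0 \<le> l2\<close> by auto
  ultimately show ?case by blast
qed

lemma shortest_walk:
  assumes "shortest_path_region X" "x \<in> X" "y \<in> X"
  obtains g u where "walk X 1 0 (path_dist X x y) g u" "g 0 = x" "g (path_dist X x y) = y"
proof -
  obtain a b \<gamma> where j: "joins_in X x y a b \<gamma>" and len: "curve_length a b \<gamma> = path_dist X x y"
    using assms unfolding shortest_path_region_def by blast
  obtain n \<tau> where "\<tau> 0 = a" "\<tau> n = b" "\<forall>i<n. smooth_arc_on (\<tau> i) (\<tau> (Suc i)) \<gamma>"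
    using j unfolding joins_in_def piecewise_smooth_on_def by blast
  then obtain l g u where w: "walk X 1 0 l g u" "g 0 = x" "g l = y"
    and l: "((\<lambda>t. norm (vector_derivative \<gamma> (at t))) has_integral l) {a..b}"
    using smooth_arcs_walk[of n \<tau> \<gamma> X] j unfolding joins_in_def by auto
  have "l = path_dist X x y"
    using integral_unique[OF l] len by (simp add: curve_length_def)
  then show thesis using w that by simp
qed

subsection \<open>Endless walks and admissible controls\<close>

lemma closed_walk_repeat:
  assumes w: "walk X c 0 L G U" and "L > 0" and loop: "G L = G 0"
  obtains g u where "\<And>T. T \<ge> 0 \<Longrightarrow> walk X c 0 T g u" "g 0 = G 0"
proof -
  \<comment> \<open>Time modulo the period \<open>L\<close>.\<close>
  define r where "r t = t - L * of_int \<lfloor>t / L\<rfloor>" for t :: real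
  have r: "r t = t - L * of_nat n" if "L * of_nat n \<le> t" "t < L * of_nat (Suc n)" for t n
  proof -
    have "\<lfloor>t / L\<rfloor> = int n"
      by (rule floor_unique) (use that \<open>L > 0\<close> in \<open>auto simp: field_simps\<close>)
    then show ?thesis by (simp add: r_def)
  qed
  define g where "g t = G (r t)" for t
  define u where "u t = U (r t)" for t
  have w_n: "walk X c (L * of_nat n) (L * of_nat (Suc n)) g u" for n
  proof -
    have "walk X c (L * of_nat n) (L * of_nat (Suc n)) (\<lambda>t. G (- (L * of_nat n) + 1 * t))
        (\<lambda>t. U (- (L * of_nat n) + 1 * t))"
      using walk_rescale[of X c "- (L * of_nat n)" 1 "L * of_nat n" "L * of_nat (Suc n)" G U] w
      by (simp add: algebra_simps)
    then show ?thesis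
    proof (rule walk_cong)
      fix t assume "t \<in> {L * of_nat n..L * of_nat (Suc n)}"
      \<comment> \<open>At the right end of a period \<open>r\<close> has already dropped to 0, and
        only the closing condition makes \<open>g\<close> agree with the shifted
        \<open>G\<close>.\<close>
      then consider "t = L * of_nat (Suc n)" | "L * of_nat n \<le> t" "t < L * of_nat (Suc n)"
        by fastforce
      then show "g t = G (- (L * of_nat n) + 1 * t)"
      proof cases
        case 1
        then have "r t = 0"
          using r[of "Suc n" t] \<open>L > 0\<close> by (simp add: algebra_simps)
        then show ?thesis using 1 loop by (simp add: g_def algebra_simps)
      qed (simp add: g_def r)
    qed (use r[of n] walkD(2)[OF w] in \<open>auto simp: u_def\<close>)
  qed
  have "walk X c 0 (L * of_nat n) g u" for n
  proof (induction n)
    case 0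
    show ?case using walk_subinterval[OF w_n[of 0], of 0 0] \<open>L > 0\<close> by simp
  next
    case (Suc n)
    then show ?case using w_n by (rule walk_combine)
  qed
  then have "walk X c 0 T g u" if "T \<ge> 0" for T
  proof -
    obtain n :: nat where "T / L \<le> n" using real_arch_simple by blast
    then have "T \<le> L * n" using \<open>L > 0\<close> by (simp add: field_simps)
    then show ?thesis
      using walk_subinterval[OF \<open>\<And>n. walk X c 0 (L * of_nat n) g u\<close>[of n], of 0 T] that by simp
  qed
  moreover have "g 0 = G 0" by (simp add: g_def r_def)
  ultimately show thesis by (rule that)
qed

lemma walk_join_endless:
  assumes w1: "walk X c a b g1 u1" and w2: "\<And>T. T \<ge> b \<Longrightarrow> walk X c b T g2 u2"
    and eq: "g1 b = g2 b" and "a \<le> T"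
  shows "walk X c a T (\<lambda>t. if t \<le> b then g1 t else g2 t) (\<lambda>t. if t < b then u1 t else u2 t)"
proof -
  \<comment> \<open>The requested time \<open>T\<close> may precede the joint, so a longer walk is
    built and cut.\<close>
  have "walk X c a (max b T) (\<lambda>t. if t \<le> b then g1 t else g2 t) (\<lambda>t. if t < b then u1 t else u2 t)"
    by (intro walk_join w1 w2 eq) simp
  then show ?thesis by (rule walk_subinterval) (use \<open>a \<le> T\<close> in auto)
qed

text \<open>Going to \<open>y\<close> along a shortest path and back is a loop of positive duration,
  which can be repeated. A single point would not suffice, as a player cannot stand still.\<close>

lemma endless_walk_exists:
  assumes X: "shortest_path_region X" and "x \<in> X" "y \<in> X" "x \<noteq> y"
  obtains g u where "\<And>T. T \<ge> 0 \<Longrightarrow> walk X 1 0 T g u" "g 0 = x"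
proof -
  interpret Metric_space X "path_dist X" using X by (simp add: shortest_path_region_def)
  define d where "d = path_dist X x y"
  have "d > 0" using assms by (simp add: d_def)
  obtain g u where w: "walk X 1 0 d g u" "g 0 = x" "g d = y"
    using shortest_walk[OF X \<open>x \<in> X\<close> \<open>y \<in> X\<close>] unfolding d_def .
  have "walk X 1 d (2 * d) (\<lambda>t. g (2 * d - t)) (\<lambda>t. - u (2 * d - t))"
    by (rule walk_reverse) (simp add: w)
  from walk_join[OF w(1) this]
  have "walk X 1 0 (2 * d) (\<lambda>t. if t \<le> d then g t else g (2 * d - t))
      (\<lambda>t. if t < d then u t else - u (2 * d - t))"
    by simp
  then show thesis
    by (rule closed_walk_repeat) (use \<open>d > 0\<close> w(2) that in auto)
qed

text \<open>On each bounded interval only finitely many times are exceptional, so the fundamental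
  theorem of calculus recovers \<open>g\<close> from \<open>u\<close>.\<close>

lemma endless_walk_admissible:
  assumes w: "\<And>T. T \<ge> a \<Longrightarrow> walk X c a T g u"
  shows "u \<in> admissible_controls X c a (g a)" "\<And>t. t \<ge> a \<Longrightarrow> trajectory c a (g a) u t = g t"
proof -
  show tr: "trajectory c a (g a) u t = g t" if t: "t \<ge> a" for t
  proof -
    obtain S where S: "finite S"
      "\<And>s. s \<in> {a<..<t} \<Longrightarrow> s \<notin> S \<Longrightarrow> (g has_vector_derivative c *\<^sub>R u s) (at s)"
      using walkE[OF w[OF t]] by metis
    have "((\<lambda>s. c *\<^sub>R u s) has_integral (g t - g a)) {a..t}"
      by (rule fundamental_theorem_of_calculus_interior_strong[OF S(1) t])
        (use S(2) walkD(3)[OF w[OF t]] in auto)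
    from integral_unique[OF this] show ?thesis
      by (simp add: trajectory_def algebra_simps)
  qed
  have "piecewise_continuous_from a u"
    unfolding piecewise_continuous_from_def
  proof (intro conjI allI impI)
    fix T
    obtain S where S: "finite S" "\<And>s. s \<in> {a<..<max a T} \<Longrightarrow> s \<notin> S \<Longrightarrow> isCont u s"
      using walkE[OF w[of "max a T"]] by (metis max.cobounded1)
    have "{t \<in> {a..T}. \<not> continuous (at t within {a..}) u} \<subseteq> insert a (insert T S)"
    proof
      fix t assume t: "t \<in> {t \<in> {a..T}. \<not> continuous (at t within {a..}) u}"
      then have "\<not> isCont u t" using continuous_at_imp_continuous_at_within by blast
      then show "t \<in> insert a (insert T S)" using S(2)[of t] t by force
    qed
    then show "finite {t \<in> {a..T}. \<not> continuous (at t within {a..}) u}"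
      by (rule finite_subset) (simp add: S(1))
  next
    fix t assume "a < t"
    then show "\<exists>v. (u \<longlongrightarrow> v) (at_left t)" using walkD(6)[OF w, of t t] by simp
  next
    fix t assume "a \<le> t"
    then show "\<exists>v. (u \<longlongrightarrow> v) (at_right t)" using walkD(7)[OF w, of "t + 1" t] by simp
  qed
  then show "u \<in> admissible_controls X c a (g a)"
    unfolding admissible_controls_def controls_def
    using tr walkD(2)[OF w[of a]] walkD(5)[OF w] by auto
qed

text \<open>A control is bounded and continuous off a finite set, hence measurable there, and the
  finite set is negligible.\<close>

lemma controls_integrable:
  assumes "u \<in> controls a"
  shows "u integrable_on {a..T}"
proof -
  define D where "D = {t \<in> {a..T}. \<not> continuous (at t within {a..}) u}"
  have D: "finite D" and n: "\<And>t. t \<ge> a \<Longrightarrow> norm (u t) = 1"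
    using assms unfolding controls_def piecewise_continuous_from_def D_def by auto
  have S: "{a..T} - D \<in> sets lebesgue"
    using D by (intro sets.Diff) (auto intro: negligible_imp_sets negligible_finite)
  have "u integrable_on ({a..T} - D)"
  proof (rule measurable_bounded_by_integrable_imp_integrable)
    have "continuous_on ({a..T} - D) u"
      unfolding continuous_on_eq_continuous_within
    proof
      fix t assume "t \<in> {a..T} - D"
      then have "continuous (at t within {a..}) u" by (simp add: D_def)
      then show "continuous (at t within {a..T} - D) u"
        by (rule continuous_within_subset) auto
    qed
    then show "u \<in> borel_measurable (lebesgue_on ({a..T} - D))"
      using S by (rule continuous_imp_measurable_on_sets_lebesgue)
    have "(\<lambda>t. 1::real) integrable_on {a..T}" by (intro integrable_continuous_real continuous_intros)
    then show "(\<lambda>t. 1::real) integrable_on {a..T} - D"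
      by (rule integrable_spike_set) (use D in \<open>auto intro: negligible_finite finite_subset\<close>)
  qed (use S n in auto)
  then show ?thesis
    by (rule integrable_spike_set) (use D in \<open>auto intro: negligible_finite finite_subset\<close>)
qed

text \<open>This makes the distance bound applicable to an arbitrary control of the opponent, and
  makes the evader's trajectory reversible.\<close>

lemma admissible_control_walk:
  assumes "u \<in> admissible_controls X c a x"
  obtains v where "\<And>T. T \<ge> a \<Longrightarrow> walk X c a T (trajectory c a x u) v"
proof
  \<comment> \<open>Before time \<open>a\<close> a control is unconstrained, so it is replaced there
    by a unit vector.\<close>
  define v where "v t = (if t \<ge> a then u t else axis 1 1)" for t
  fix T :: real assume "a \<le> T"
  let ?g = "trajectory c a x u"
  define D where "D = {t \<in> {a..T}. \<not> continuous (at t within {a..}) u}"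
  have u: "u \<in> controls a" and X: "\<And>t. t \<ge> a \<Longrightarrow> ?g t \<in> X"
    using assms by (auto simp: admissible_controls_def)
  have D: "finite D"
    and left: "\<And>t. a < t \<Longrightarrow> \<exists>w. (u \<longlongrightarrow> w) (at_left t)"
    and right: "\<And>t. a \<le> t \<Longrightarrow> \<exists>w. (u \<longlongrightarrow> w) (at_right t)"
    and n: "\<And>t. a \<le> t \<Longrightarrow> norm (u t) = 1"
    using u unfolding controls_def piecewise_continuous_from_def D_def by auto
  have int: "u integrable_on {a..T}"
    using u by (rule controls_integrable)
  have "continuous_on {a..T} ?g"
    unfolding trajectory_def
    using indefinite_integral_continuous_1[OF int]
    by (intro continuous_on_add continuous_on_const continuous_on_scaleR)
  moreover have "isCont v t \<and> (?g has_vector_derivative c *\<^sub>R v t) (at t)"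
    if t: "t \<in> {a<..<T} - D" for t
  proof
    have "at t within {a..} = at t"
      using t by (intro at_within_interior) simp
    moreover have "continuous (at t within {a..}) u"
      using t unfolding D_def by fastforce
    ultimately have "isCont u t" by (rule subst)
    have "\<forall>\<^sub>F s in nhds t. s \<in> {a<..}"
      using t by (intro eventually_nhds_in_open) auto
    then have "\<forall>\<^sub>F s in nhds t. u s = v s" by eventually_elim (simp add: v_def)
    then show "isCont v t" using isCont_cong[THEN iffD1, OF _ \<open>isCont u t\<close>] by simp
    have "((\<lambda>t. integral {a..t} u) has_vector_derivative u t) (at t within {a..T} - {})"
      using \<open>isCont u t\<close> t int
      by (intro integral_has_vector_derivative_continuous_at)
        (auto intro: continuous_at_imp_continuous_at_within)
    then have "((\<lambda>t. integral {a..t} u) has_vector_derivative u t) (at t)"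
      using t by (simp add: at_within_Icc_at)
    from has_vector_derivative_add[OF has_vector_derivative_const
        bounded_linear.has_vector_derivative[OF bounded_linear_scaleR_right this]]
    show "(?g has_vector_derivative c *\<^sub>R v t) (at t)"
      using t by (simp add: trajectory_def[abs_def] v_def)
  qed
  moreover have "\<exists>w. (v \<longlongrightarrow> w) (at_left t)" if t: "t \<in> {a<..T}" for t
  proof -
    have "\<forall>\<^sub>F s in at_left t. s \<in> {a<..<t}"
      using t by (intro eventually_at_left_real) auto
    then have "\<forall>\<^sub>F s in at_left t. u s = v s"
      by eventually_elim (simp add: v_def)
    then show ?thesis
      using left[of t] t by (auto dest: tendsto_cong[THEN iffD1])
  qed
  moreover have "\<exists>w. (v \<longlongrightarrow> w) (at_right t)" if t: "t \<in> {a..<T}" for t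
  proof -
    have "\<forall>\<^sub>F s in at_right t. s \<in> {t<..<T}"
      using t by (intro eventually_at_right_real) auto
    then have "\<forall>\<^sub>F s in at_right t. u s = v s"
      by eventually_elim (use t in \<open>simp add: v_def\<close>)
    then show ?thesis
      using right[of t] t by (auto dest: tendsto_cong[THEN iffD1])
  qed
  moreover have "norm (v t) = 1" for t using n by (simp add: v_def)
  ultimately show "walk X c a T ?g v"
    unfolding walk_def using \<open>a \<le> T\<close> X D by auto
qed

subsection \<open>The two inclusions\<close>

lemma dominance_subset_reachable:
  assumes X: "shortest_path_region X" and "\<alpha> > 1"
    and P: "xp0 \<in> X" and E: "xe0 \<in> X" and ne: "xp0 \<noteq> xe0"
  shows "dominance_region X \<alpha> xp0 xe0 \<subseteq> reachable_region X \<alpha> t0 xp0 xe0"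
proof
  interpret Metric_space X "path_dist X" using X by (simp add: shortest_path_region_def)
  fix x assume "x \<in> dominance_region X \<alpha> xp0 xe0"
  then have "x \<in> X" and dom: "path_dist X x xp0 > \<alpha> * path_dist X x xe0"
    by (auto simp: dominance_region_def)
  define d where "d = path_dist X xe0 x"
  define t1 where "t1 = t0 + d"
  obtain g1 u1 where w1: "walk X 1 0 d g1 u1" "g1 0 = xe0" "g1 d = x"
    using shortest_walk[OF X E \<open>x \<in> X\<close>] unfolding d_def .
  have v1: "walk X 1 t0 t1 (\<lambda>t. g1 (- t0 + 1 * t)) (\<lambda>t. u1 (- t0 + 1 * t))"
    using walk_rescale[of X 1 "- t0" 1 t0 t1 g1 u1] w1(1) by (simp add: t1_def)
  have "t0 \<le> t1" using walkD(1)[OF v1] .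
  \<comment> \<open>One of the two initial positions differs from \<open>x\<close>; it gives the
    evader somewhere to go after reaching \<open>x\<close>.\<close>
  obtain y where "y \<in> X" "y \<noteq> x" using P E ne by metis
  then obtain g2 u2 where w2: "\<And>T. T \<ge> 0 \<Longrightarrow> walk X 1 0 T g2 u2" "g2 0 = x"
    using endless_walk_exists[OF X \<open>x \<in> X\<close>] by metis
  have v2: "walk X 1 t1 T (\<lambda>t. g2 (- t1 + 1 * t)) (\<lambda>t. u2 (- t1 + 1 * t))" if "T \<ge> t1" for T
    using walk_rescale[of X 1 "- t1" 1 t1 T g2 u2] w2(1) that by simp
  define g where "g = (\<lambda>t. if t \<le> t1 then g1 (- t0 + 1 * t) else g2 (- t1 + 1 * t))"
  define ue where "ue = (\<lambda>t. if t < t1 then u1 (- t0 + 1 * t) else u2 (- t1 + 1 * t))"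
  have w: "walk X 1 t0 T g ue" if "T \<ge> t0" for T
    unfolding g_def ue_def
    by (rule walk_join_endless[OF v1 v2 _ that]) (simp_all add: t1_def w1 w2)
  have g: "g t0 = xe0" "g t1 = x" using \<open>t0 \<le> t1\<close> w1 by (auto simp: g_def t1_def)
  have ue: "ue \<in> admissible_controls X 1 t0 xe0"
    and tre: "\<And>t. t \<ge> t0 \<Longrightarrow> trajectory 1 t0 xe0 ue t = g t"
    using endless_walk_admissible[of t0 X 1 g ue, OF w] unfolding g by blast+
  \<comment> \<open>Capture is delayed by \<open>\<epsilon>\<close> beyond \<open>t1\<close>: the terminal time is an infimum, so excluding capture up
    to \<open>t1\<close> would not suffice.\<close>
  define \<epsilon> where "\<epsilon> = (path_dist X x xp0 - \<alpha> * d) / (\<alpha> + 1)"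
  have "\<epsilon> > 0" using dom \<open>\<alpha> > 1\<close> by (simp add: \<epsilon>_def d_def commute)
  have "ereal t1 < terminal_time \<alpha> t0 xp0 xe0 up ue" if up: "up \<in> admissible_controls X \<alpha> t0 xp0" for up
  proof -
    obtain v where v: "\<And>T. T \<ge> t0 \<Longrightarrow> walk X \<alpha> t0 T (trajectory \<alpha> t0 xp0 up) v"
      using admissible_control_walk[OF up] by blast
    have "t1 + \<epsilon> \<le> s" if s: "s \<ge> t0" "trajectory \<alpha> t0 xp0 up s = trajectory 1 t0 xe0 ue s" for s
    proof -
      have "trajectory \<alpha> t0 xp0 up t0 = xp0" by (simp add: trajectory_def)
      then have 1: "path_dist X xp0 (g s) \<le> \<alpha> * (s - t0)"
        using walk_path_dist[OF v[OF s(1)]] \<open>\<alpha> > 1\<close> s tre by simp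
      \<comment> \<open>The evader's own path links the capture point with \<open>x\<close>, whether
        capture happens before or after \<open>t1\<close>.\<close>
      have "walk X 1 (min s t1) (max s t1) g ue"
        by (rule walk_subinterval[OF w[of "max s t1"]]) (use s \<open>t0 \<le> t1\<close> in auto)
      from walk_path_dist[OF this] have 2: "path_dist X (g s) x \<le> \<bar>s - t1\<bar>"
        using g commute[of "g s" "g t1"] by (auto simp: min_def max_def split: if_splits)
      have "g s \<in> X" using walkD(5)[OF w[OF s(1)], of s] s by simp
      then have 3: "path_dist X xp0 x \<le> \<alpha> * (s - t0) + \<bar>s - t1\<bar>"
        using triangle[OF P _ \<open>x \<in> X\<close>, of "g s"] 1 2 by linarith
      \<comment> \<open>For \<open>s >= t1\<close> the bound in \<open>3\<close> equals
        \<open>\<alpha> * d + (\<alpha> + 1) * (s - t1)\<close>; comparison with this identity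
        explains the value of \<epsilon>.\<close>
      have 4: "path_dist X xp0 x = (\<alpha> + 1) * \<epsilon> + \<alpha> * d"
        using \<open>\<alpha> > 1\<close> by (simp add: \<epsilon>_def commute)
      have "s \<ge> t1"
      proof (rule ccontr)
        assume "\<not> s \<ge> t1"
        \<comment> \<open>After an early capture the pursuer could follow the evader's remaining
          path at speed 1, which is below \<alpha>.\<close>
        then have "\<alpha> * (s - t0) + \<bar>s - t1\<bar> \<le> \<alpha> * (s - t0) + \<alpha> * (t1 - s)"
          using \<open>\<alpha> > 1\<close> by simp
        also have "\<dots> = \<alpha> * d" by (simp add: t1_def algebra_simps)
        finally show False using 3 4 \<open>\<epsilon> > 0\<close> \<open>\<alpha> > 1\<close> mult_pos_pos[of "\<alpha> + 1" \<epsilon>] by linarith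
      qed
      then have "(\<alpha> + 1) * \<epsilon> \<le> (\<alpha> + 1) * (s - t1)"
        using 3 4 by (simp add: t1_def algebra_simps)
      then show ?thesis using \<open>\<alpha> > 1\<close> by simp
    qed
    then have "ereal (t1 + \<epsilon>) \<le> terminal_time \<alpha> t0 xp0 xe0 up ue"
      unfolding terminal_time_def by (auto intro!: Inf_greatest)
    moreover have "ereal t1 < ereal (t1 + \<epsilon>)" using \<open>\<epsilon> > 0\<close> by simp
    ultimately show ?thesis by (rule less_le_trans[rotated])
  qed
  then show "x \<in> reachable_region X \<alpha> t0 xp0 xe0"
    unfolding reachable_region_def
    using \<open>x \<in> X\<close> ue tre[OF \<open>t0 \<le> t1\<close>] g(2) \<open>t0 \<le> t1\<close> by auto
qed

lemma reachable_subset_dominance: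
  assumes X: "shortest_path_region X" and "\<alpha> > 1"
    and P: "xp0 \<in> X" and E: "xe0 \<in> X" and ne: "xp0 \<noteq> xe0"
  shows "reachable_region X \<alpha> t0 xp0 xe0 \<subseteq> dominance_region X \<alpha> xp0 xe0"
proof (rule subsetI, rule ccontr)
  interpret Metric_space X "path_dist X" using X by (simp add: shortest_path_region_def)
  fix x assume "x \<in> reachable_region X \<alpha> t0 xp0 xe0" and ndom: "x \<notin> dominance_region X \<alpha> xp0 xe0"
  then obtain ue where "x \<in> X" and ue: "ue \<in> admissible_controls X 1 t0 xe0"
    and reach: "\<And>up. up \<in> admissible_controls X \<alpha> t0 xp0 \<Longrightarrow>
      \<exists>t\<ge>t0. ereal t < terminal_time \<alpha> t0 xp0 xe0 up ue \<and> trajectory 1 t0 xe0 ue t = x"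
    unfolding reachable_region_def by blast
  define E where "E = trajectory 1 t0 xe0 ue"
  obtain v where v: "\<And>T. T \<ge> t0 \<Longrightarrow> walk X 1 t0 T E v"
    using admissible_control_walk[OF ue] unfolding E_def by blast
  have E0: "E t0 = xe0" by (simp add: E_def trajectory_def)
  define V where "V = {t. t0 \<le> t \<and> E t = x}"
  \<comment> \<open>The hypothesis yields a visit to \<open>x\<close> only against some pursuer, so
    any admissible control of the pursuer is produced first.\<close>
  obtain t' where t': "t' \<in> V"
  proof -
    obtain g u where "\<And>T. T \<ge> 0 \<Longrightarrow> walk X 1 0 T g u" "g 0 = xp0"
      using endless_walk_exists[OF X P \<open>xe0 \<in> X\<close> ne] by metis
    then have w: "walk X \<alpha> t0 T (\<lambda>t. g (- \<alpha> * t0 + \<alpha> * t)) (\<lambda>t. u (- \<alpha> * t0 + \<alpha> * t))"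
      if "T \<ge> t0" for T
      using walk_rescale[of X 1 "- \<alpha> * t0" \<alpha> t0 T g u] that \<open>\<alpha> > 1\<close> by simp
    have "(\<lambda>t. u (- \<alpha> * t0 + \<alpha> * t)) \<in> admissible_controls X \<alpha> t0 xp0"
      using endless_walk_admissible(1)[of t0 X \<alpha>, OF w] \<open>g 0 = xp0\<close> by simp
    from reach[OF this] show thesis using that by (auto simp: V_def E_def)
  qed
  define ts where "ts = Inf V"
  have "ts \<in> V"
  proof -
    \<comment> \<open>Restricting to times up to a known visit gives a compact set, so the first
      visit is attained.\<close>
    have "closed {t \<in> {t0..t'}. E t = x}"
      using walkD(3)[OF v[of t']] t' by (intro continuous_closed_preimage_constant) (auto simp: V_def)
    moreover have "{t \<in> {t0..t'}. E t = x} \<noteq> {}" "bdd_below {t \<in> {t0..t'}. E t = x}"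
      using t' by (auto simp: V_def intro: bdd_belowI[of _ t0])
    ultimately have m: "Inf {t \<in> {t0..t'}. E t = x} \<in> {t \<in> {t0..t'}. E t = x}" (is "?m \<in> _")
      by (intro closed_contains_Inf)
    have "?m \<le> t" if "t \<in> V" for t
    proof (cases "t \<le> t'")
      case True
      then show ?thesis
        using that by (intro cInf_lower) (auto simp: V_def intro: bdd_belowI[of _ t0])
    qed (use m in auto)
    then have "ts = ?m"
      unfolding ts_def using m by (intro cInf_eq_minimum) (auto simp: V_def)
    then show ?thesis using m by (auto simp: V_def)
  qed
  have ts: "ts \<ge> t0" "E ts = x" and first: "\<And>t. t0 \<le> t \<Longrightarrow> E t = x \<Longrightarrow> ts \<le> t"
    using \<open>ts \<in> V\<close> by (auto simp: V_def ts_def intro!: cInf_lower bdd_belowI[of _ t0])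
  define d where "d = path_dist X xp0 x"
  define t1 where "t1 = t0 + d / \<alpha>"
  \<comment> \<open>Failure of dominance enters here: the pursuer, going straight to
    \<open>x\<close>, arrives no later than the evader's first visit.\<close>
  have "d \<le> \<alpha> * path_dist X xe0 x"
    using ndom \<open>x \<in> X\<close> by (simp add: dominance_region_def d_def commute)
  also have "\<dots> \<le> \<alpha> * (ts - t0)"
    using walk_path_dist[OF v[OF ts(1)]] E0 ts \<open>\<alpha> > 1\<close> by simp
  finally have "t1 \<le> ts" using \<open>\<alpha> > 1\<close> by (simp add: t1_def field_simps)
  have "t0 \<le> t1" using \<open>\<alpha> > 1\<close> by (simp add: t1_def d_def)
  \<comment> \<open>The meeting time: a pursuer walking back from \<open>x\<close> since \<open>t1\<close> is at \<open>E (ts - \<alpha> * (t - t1))\<close>,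
    so it meets the evader when \<open>t = ts - \<alpha> * (t - t1)\<close>.\<close>
  define tm where "tm = (ts + \<alpha> * t1) / (1 + \<alpha>)"
  have tm: "(1 + \<alpha>) * tm = ts + \<alpha> * t1" using \<open>\<alpha> > 1\<close> by (simp add: tm_def)
  have "t1 \<le> tm"
    using \<open>t1 \<le> ts\<close> \<open>\<alpha> > 1\<close> by (simp add: tm_def field_simps)
  have "tm \<le> ts"
    using \<open>t1 \<le> ts\<close> \<open>\<alpha> > 1\<close> by (simp add: tm_def field_simps)
  obtain g1 u1 where w1: "walk X 1 0 d g1 u1" "g1 0 = xp0" "g1 d = x"
    using shortest_walk[OF X P \<open>x \<in> X\<close>] unfolding d_def .
  define h1 where "h1 t = g1 (- \<alpha> * t0 + \<alpha> * t)" for t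
  have v1: "walk X \<alpha> t0 t1 h1 (\<lambda>t. u1 (- \<alpha> * t0 + \<alpha> * t))"
    unfolding h1_def
    using walk_rescale[of X 1 "- \<alpha> * t0" \<alpha> t0 t1 g1 u1] w1(1) \<open>\<alpha> > 1\<close>
    by (simp add: t1_def algebra_simps)
  define h2 where "h2 t = E (ts + \<alpha> * t1 - \<alpha> * t)" for t
  \<comment> \<open>The backward walk is first made at speed 1 on the clock
    \<open>\<alpha> * t\<close> and then rescaled. On the evader's clock it runs from
    \<open>ts\<close> down to \<open>tm\<close>.\<close>
  have "walk X 1 (\<alpha> * t1) (\<alpha> * tm) (\<lambda>t. E (ts + \<alpha> * t1 - t)) (\<lambda>t. - v (ts + \<alpha> * t1 - t))"
  proof (rule walk_reverse, rule walk_subinterval[OF v[OF ts(1)]])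
    show "t0 \<le> ts + \<alpha> * t1 - \<alpha> * tm"
      using tm \<open>t0 \<le> t1\<close> \<open>t1 \<le> tm\<close> by (simp add: algebra_simps)
  qed (use \<open>t1 \<le> tm\<close> \<open>\<alpha> > 1\<close> in auto)
  from walk_rescale[of X 1 0 \<alpha> t1 tm, simplified, OF this]
  have v2: "walk X \<alpha> t1 tm h2 (\<lambda>t. - v (ts + \<alpha> * t1 - \<alpha> * t))"
    using \<open>\<alpha> > 1\<close> by (simp add: h2_def[abs_def])
  \<comment> \<open>After the meeting the pursuer must keep moving inside \<open>X\<close>. The
    evader's future path, traversed \<alpha> times as fast from \<open>E tm\<close> on, is available
    for that.\<close>
  define h3 where "h3 t = E ((1 - \<alpha>) * tm + \<alpha> * t)" for t
  have v3: "walk X \<alpha> tm T h3 (\<lambda>t. v ((1 - \<alpha>) * tm + \<alpha> * t))" if "T \<ge> tm" for T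
  proof -
    have "tm \<le> (1 - \<alpha>) * tm + \<alpha> * T"
      using that \<open>\<alpha> > 1\<close> by (simp add: algebra_simps)
    then have "walk X 1 tm ((1 - \<alpha>) * tm + \<alpha> * T) E v"
      using \<open>t0 \<le> t1\<close> \<open>t1 \<le> tm\<close> by (intro walk_subinterval[OF v[of "(1 - \<alpha>) * tm + \<alpha> * T"]]) auto
    moreover have "(1 - \<alpha>) * tm + \<alpha> * tm = tm" by (simp add: algebra_simps)
    ultimately show ?thesis
      using walk_rescale[of X 1 "(1 - \<alpha>) * tm" \<alpha> tm T E v] \<open>\<alpha> > 1\<close> by (simp add: h3_def[abs_def])
  qed
  have "h1 t1 = h2 t1"
    using w1 ts \<open>\<alpha> > 1\<close> by (simp add: h1_def h2_def t1_def algebra_simps)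
  note v12 = walk_join[OF v1 v2 this]
  have meet: "h2 tm = E tm" "h3 tm = E tm"
  proof -
    have "ts + \<alpha> * t1 - \<alpha> * tm = tm" "(1 - \<alpha>) * tm + \<alpha> * tm = tm"
      using tm by (simp_all add: algebra_simps)
    then show "h2 tm = E tm" "h3 tm = E tm" by (simp_all add: h2_def h3_def)
  qed
  have eq: "(if tm \<le> t1 then h1 tm else h2 tm) = h3 tm"
    using meet \<open>h1 t1 = h2 t1\<close> \<open>t1 \<le> tm\<close> by auto
  define up where "up = (\<lambda>t. if t < tm then if t < t1 then u1 (- \<alpha> * t0 + \<alpha> * t)
    else - v (ts + \<alpha> * t1 - \<alpha> * t) else v ((1 - \<alpha>) * tm + \<alpha> * t))"
  define g where "g = (\<lambda>t. if t \<le> tm then if t \<le> t1 then h1 t else h2 t else h3 t)"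
  have w: "walk X \<alpha> t0 T g up" if "T \<ge> t0" for T
    unfolding g_def up_def by (rule walk_join_endless[OF v12 v3 eq that])
  have g0: "g t0 = xp0"
    using \<open>t0 \<le> t1\<close> \<open>t1 \<le> tm\<close> w1 by (simp add: g_def h1_def)
  have up: "up \<in> admissible_controls X \<alpha> t0 xp0"
    and trp: "\<And>t. t \<ge> t0 \<Longrightarrow> trajectory \<alpha> t0 xp0 up t = g t"
    using endless_walk_admissible[of t0 X \<alpha> g up, OF w] unfolding g0 by blast+
  have "t0 \<le> tm" using \<open>t0 \<le> t1\<close> \<open>t1 \<le> tm\<close> by simp
  have "g tm = E tm" using eq meet by (simp add: g_def)
  then have "terminal_time \<alpha> t0 xp0 xe0 up ue \<le> ereal tm"
    unfolding terminal_time_def using trp[OF \<open>t0 \<le> tm\<close>] \<open>t0 \<le> tm\<close>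
    by (intro Inf_lower) (auto simp: E_def)
  moreover obtain t where "t \<ge> t0" "ereal t < terminal_time \<alpha> t0 xp0 xe0 up ue" "E t = x"
    using reach[OF up] by (auto simp: E_def)
  \<comment> \<open>Strictness matters when both players arrive at \<open>x\<close> together, since
    then \<open>tm = ts\<close>.\<close>
  ultimately have "t < tm" by (meson less_ereal.simps(1) order_less_le_trans)
  then show False using first[OF \<open>t \<ge> t0\<close> \<open>E t = x\<close>] \<open>tm \<le> ts\<close> by simp
qed

theorem theorem5:
  fixes X :: "(real^2) set" and \<alpha> t0 :: real and xp0 xe0 :: "real^2"
  assumes "closed X" and "connected X"
    and "shortest_path_region X"
    and "\<alpha> > 1"
    and "xp0 \<in> X" and "xe0 \<in> X" and "xp0 \<noteq> xe0"
  shows "reachable_region X \<alpha> t0 xp0 xe0 = dominance_region X \<alpha> xp0 xe0"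
  using reachable_subset_dominance[OF assms(3-7)] dominance_subset_reachable[OF assms(3-7)]
  by (rule equalityI)

end
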